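(* Let $\alpha=\frac16\sqrt{\frac32\pm\frac{\sqrt{65}}{6}}$ and $\beta=\frac{1}{54\alpha}=\frac16\sqrt{\frac32\mp\frac{\sqrt{65}}{6}}$, for either choice of sign (upper signs together or lower signs together). Then the vector $$\begin{aligned} |\phi_{2333}\rangle = &-\alpha|0011\rangle-\beta|0012\rangle+\beta|0021\rangle+\alpha|0022\rangle\\ &-\beta|0101\rangle+\alpha|0102\rangle+\beta|0110\rangle+\alpha|0120\rangle\\ &-\alpha|0201\rangle+\beta|0202\rangle-\alpha|0210\rangle-\beta|0220\rangle\\ &-\beta|1011\rangle+\alpha|1012\rangle-\alpha|1021\rangle+\beta|1022\rangle\\ &+\alpha|1101\rangle+\beta|1102\rangle-\alpha|1110\rangle+\beta|1120\rangle\\ &-\beta|1201\rangle-\alpha|1202\rangle-\beta|1210\rangle+\alpha|1220\rangle \end{aligned}$$ in $\mathbb{C}^2\otimes\mathbb{C}^3\otimes\mathbb{C}^3\otimes\mathbb{C}^3$ is a (normalized) pure state that is maximally entangled across every bipartition. In particular, an absolutely maximally entangled state exists in a system with local dimensions $2\times3\times3\times3$.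
   Context: Here $|abcd\rangle=|a\rangle\otimes|b\rangle\otimes|c\rangle\otimes|d\rangle$ with $a\in\{0,1\}$ and $b,c,d\in\{0,1,2\}$ are the standard basis vectors of $\mathbb{C}^2\otimes\mathbb{C}^3\otimes\mathbb{C}^3\otimes\mathbb{C}^3$. A pure state (unit vector) $|\psi\rangle\in\mathbb{C}^{d_1}\otimes\dots\otimes\mathbb{C}^{d_n}$ of a system with mixed local dimensions is called absolutely maximally entangled (maximally entangled across every bipartition) if for every subset $S\subseteq\{1,\dots,n\}$ of parties with $d_S:=\prod_{i\in S}d_i\le\prod_{i\in S^c}d_i$, the reduction onto $S$ is maximally mixed: $\operatorname{Tr}_{S^c}(|\psi\rangle\langle\psi|)=\mathbb{1}_S/d_S$, where $S^c$ is the complement of $S$ and $\operatorname{Tr}_{S^c}$ the partial trace over the parties in $S^c$. *)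

theory Defs
  imports "HOL-Analysis.Analysis"
begin

(* A system has a finite set P of parties, party i with local dimension d i. The vector space
   of the parties in P, i.e. the tensor product of the spaces C^(d i), has the standard product
   basis indexed by the multi-indices in "multi_index d P"; vectors are given by their
   coordinates in this basis, and operators by their matrix entries. *)

definition multi_index :: "('p \<Rightarrow> nat) \<Rightarrow> 'p set \<Rightarrow> ('p \<Rightarrow> nat) set" where
  "multi_index d P = (\<Pi>\<^sub>E i\<in>P. {..<d i})"

type_synonym 'p vector = "('p \<Rightarrow> nat) \<Rightarrow> complex"
type_synonym 'p operator = "('p \<Rightarrow> nat) \<Rightarrow> ('p \<Rightarrow> nat) \<Rightarrow> complex"

definition state_space :: "('p \<Rightarrow> nat) \<Rightarrow> 'p set \<Rightarrow> 'p vector set" where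
  "state_space d P = {\<psi>. \<forall>x. x \<notin> multi_index d P \<longrightarrow> \<psi> x = 0}"

definition state_norm :: "('p \<Rightarrow> nat) \<Rightarrow> 'p set \<Rightarrow> 'p vector \<Rightarrow> real" where
  "state_norm d P \<psi> = sqrt (\<Sum>x\<in>multi_index d P. (cmod (\<psi> x))\<^sup>2)"

definition pure_state :: "('p \<Rightarrow> nat) \<Rightarrow> 'p set \<Rightarrow> 'p vector \<Rightarrow> bool" where
  "pure_state d P \<psi> \<longleftrightarrow> \<psi> \<in> state_space d P \<and> state_norm d P \<psi> = 1"

definition tensor :: "('p \<Rightarrow> nat) \<Rightarrow> 'p set \<Rightarrow> ('p \<Rightarrow> nat \<Rightarrow> complex) \<Rightarrow> 'p vector" where
  "tensor d P v = (\<lambda>x. if x \<in> multi_index d P then \<Prod>i\<in>P. v i (x i) else 0)"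

definition std_basis :: "nat \<Rightarrow> nat \<Rightarrow> complex" where
  "std_basis k = (\<lambda>j. if j = k then 1 else 0)"

definition density :: "'p vector \<Rightarrow> 'p operator" where
  "density \<psi> = (\<lambda>x y. \<psi> x * cnj (\<psi> y))"

(* For an operator A of the parties in the disjoint union of S and T, the trace over T; the
   result is meaningful on the multi-indices of S. *)
definition partial_trace ::
  "('p \<Rightarrow> nat) \<Rightarrow> 'p set \<Rightarrow> 'p set \<Rightarrow> 'p operator \<Rightarrow> 'p operator" where
  "partial_trace d S T A =
     (\<lambda>x y. \<Sum>z\<in>multi_index d T. A (merge S T (x, z)) (merge S T (y, z)))"

definition maximally_mixed :: "('p \<Rightarrow> nat) \<Rightarrow> 'p set \<Rightarrow> 'p operator \<Rightarrow> bool" where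
  "maximally_mixed d S \<rho> \<longleftrightarrow>
     (\<forall>x\<in>multi_index d S. \<forall>y\<in>multi_index d S.
        \<rho> x y = (if x = y then 1 else 0) / of_nat (\<Prod>i\<in>S. d i))"

definition absolutely_maximally_entangled ::
  "('p \<Rightarrow> nat) \<Rightarrow> 'p set \<Rightarrow> 'p vector \<Rightarrow> bool" where
  "absolutely_maximally_entangled d P \<psi> \<longleftrightarrow>
     pure_state d P \<psi> \<and>
     (\<forall>S. S \<subseteq> P \<and> (\<Prod>i\<in>S. d i) \<le> (\<Prod>i\<in>P - S. d i) \<longrightarrow>
        maximally_mixed d S (partial_trace d S (P - S) (density \<psi>)))"

definition parties :: "nat set" where
  "parties = {1..4}"

definition dims2333 :: "nat \<Rightarrow> nat" where
  "dims2333 i = (if i = 1 then 2 else 3)"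

definition ket :: "nat \<Rightarrow> nat \<Rightarrow> nat \<Rightarrow> nat \<Rightarrow> nat vector" where
  "ket a b c e = tensor dims2333 parties (\<lambda>i. std_basis ([a, b, c, e] ! (i - 1)))"

definition phi2333 :: "real \<Rightarrow> real \<Rightarrow> nat vector" where
  "phi2333 \<alpha> \<beta> = (\<lambda>x.
     - \<alpha> * ket 0 0 1 1 x - \<beta> * ket 0 0 1 2 x + \<beta> * ket 0 0 2 1 x + \<alpha> * ket 0 0 2 2 x
     - \<beta> * ket 0 1 0 1 x + \<alpha> * ket 0 1 0 2 x + \<beta> * ket 0 1 1 0 x + \<alpha> * ket 0 1 2 0 x
     - \<alpha> * ket 0 2 0 1 x + \<beta> * ket 0 2 0 2 x - \<alpha> * ket 0 2 1 0 x - \<beta> * ket 0 2 2 0 x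
     - \<beta> * ket 1 0 1 1 x + \<alpha> * ket 1 0 1 2 x - \<alpha> * ket 1 0 2 1 x + \<beta> * ket 1 0 2 2 x
     + \<alpha> * ket 1 1 0 1 x + \<beta> * ket 1 1 0 2 x - \<alpha> * ket 1 1 1 0 x + \<beta> * ket 1 1 2 0 x
     - \<beta> * ket 1 2 0 1 x - \<alpha> * ket 1 2 0 2 x - \<beta> * ket 1 2 1 0 x + \<alpha> * ket 1 2 2 0 x)"

end

theory Submission
  imports Defs
begin

text \<open>
  Every \<open>S\<close> with \<open>d\<^sub>S \<le> d\<^bsub>S\<^sup>c\<^esub>\<close> lies in one of the sets \<open>{1, i}\<close> with \<open>i \<in> {2, 3, 4}\<close>, and partial
  traces of maximally mixed operators are maximally mixed. So it suffices to compute the three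
  \<open>6 \<times> 6\<close> reductions onto \<open>{1, i}\<close>: the mixed terms cancel because of the signs, and the diagonal
  entries are all \<open>2 (\<alpha>\<^sup>2 + \<beta>\<^sup>2) = 1/6\<close>. The norm is the reduction onto the empty set.
\<close>

section \<open>Partial traces and maximally mixed reductions\<close>

lemma sum_multi_index_empty: "(\<Sum>z\<in>multi_index d {}. f z) = f (\<lambda>_. undefined)"
  by (simp add: multi_index_def)

lemma sum_multi_index_insert:
  assumes "k \<notin> T"
  shows "(\<Sum>z\<in>multi_index d (insert k T). f z) = (\<Sum>j<d k. \<Sum>z\<in>multi_index d T. f (z(k := j)))"
proof -
  have "inj_on (\<lambda>(j, z). z(k := j)) ({..<d k} \<times> multi_index d T)"
    unfolding multi_index_def using assms by (rule inj_combinator)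
  then show ?thesis
    unfolding multi_index_def PiE_insert_eq
    by (simp add: sum.reindex sum.cartesian_product case_prod_unfold)
qed

text \<open>Tracing out \<open>insert k T\<close> can be done in stages, \<open>T\<close> first and
  then \<open>k\<close>. \<open>merge\<close> does not care whether the value at \<open>k\<close>
  comes from its left or its right argument.\<close>

lemma partial_trace_insert:
  assumes "k \<notin> S" "k \<notin> T"
  shows "partial_trace d S (insert k T) A x y =
    (\<Sum>j<d k. partial_trace d (insert k S) T A (x(k := j)) (y(k := j)))"
proof -
  have "merge S (insert k T) (x, z(k := j)) = merge (insert k S) T (x(k := j), z)" for x z :: "'a \<Rightarrow> nat" and j
    using assms by (auto simp: merge_def)
  then show ?thesis
    using assms by (simp add: partial_trace_def sum_multi_index_insert)
qed

text \<open>The trace over \<open>k\<close> adds \<open>d k\<close> equal entries of the larger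
  reduction, which cancels the factor \<open>d k\<close> in its denominator; this is where
  \<open>d k > 0\<close> enters.\<close>

lemma maximally_mixed_reduce:
  assumes "maximally_mixed d (insert k S) (partial_trace d (insert k S) T A)"
    and "k \<notin> S" "k \<notin> T" "finite S" "d k > 0"
  shows "maximally_mixed d S (partial_trace d S (insert k T) A)"
  unfolding maximally_mixed_def
proof (intro ballI)
  fix x y assume x: "x \<in> multi_index d S" and y: "y \<in> multi_index d S"
  have "x(k := j) = y(k := j) \<longleftrightarrow> x = y" for j
  proof
    assume eq: "x(k := j) = y(k := j)"
    \<comment> \<open>Both sides are \<open>undefined\<close>, since \<open>k\<close> lies outside
      \<open>S\<close>; hence overwriting position \<open>k\<close> loses no information.\<close>
    have "x k = y k"
      using x y \<open>k \<notin> S\<close> by (auto simp: multi_index_def PiE_def extensional_def)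
    with eq show "x = y"
      by (metis fun_upd_triv fun_upd_upd)
  qed simp
  moreover have "x(k := j) \<in> multi_index d (insert k S)" "y(k := j) \<in> multi_index d (insert k S)"
    if "j < d k" for j
    using x y that by (auto simp: multi_index_def PiE_def extensional_def)
  ultimately have "partial_trace d S (insert k T) A x y =
      (\<Sum>j<d k. (if x = y then 1 else 0) / of_nat (\<Prod>i\<in>insert k S. d i))"
    using assms(1) unfolding partial_trace_insert[OF assms(2,3)] maximally_mixed_def
    by (intro sum.cong) auto
  then show "partial_trace d S (insert k T) A x y =
      (if x = y then 1 else 0) / of_nat (\<Prod>i\<in>S. d i)"
    using assms by simp
qed

text \<open>The reduction onto no party is a scalar, the squared norm, and the empty product makes
  its maximally mixed value 1.\<close>

lemma state_norm_eq_1: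
  assumes "maximally_mixed d {} (partial_trace d {} P (density \<psi>))"
  shows "state_norm d P \<psi> = 1"
proof -
  have restrict: "merge {} P (u, z) = z" if "z \<in> multi_index d P" for u z
    using that by (auto simp: merge_def multi_index_def PiE_def extensional_def)
  have "complex_of_real (\<Sum>z\<in>multi_index d P. (cmod (\<psi> z))\<^sup>2) =
      partial_trace d {} P (density \<psi>) (\<lambda>_. undefined) (\<lambda>_. undefined)"
    by (simp add: partial_trace_def density_def restrict complex_norm_square
        del: of_real_power)
  also have "\<dots> = 1"
    using assms by (simp add: maximally_mixed_def multi_index_def)
  finally show ?thesis
    by (simp only: state_norm_def of_real_eq_1_iff real_sqrt_one)
qed

section \<open>The amplitudes as a real table\<close>

definition coeff2333 :: "real \<Rightarrow> real \<Rightarrow> nat \<Rightarrow> nat \<Rightarrow> nat \<Rightarrow> nat \<Rightarrow> real" where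
  "coeff2333 \<alpha> \<beta> a b c e =
    [[[[0, 0, 0], [0, - \<alpha>, - \<beta>], [0, \<beta>, \<alpha>]],
      [[0, - \<beta>, \<alpha>], [\<beta>, 0, 0], [\<alpha>, 0, 0]],
      [[0, - \<alpha>, \<beta>], [- \<alpha>, 0, 0], [- \<beta>, 0, 0]]],
     [[[0, 0, 0], [0, - \<beta>, \<alpha>], [0, - \<alpha>, \<beta>]],
      [[0, \<alpha>, \<beta>], [- \<alpha>, 0, 0], [\<beta>, 0, 0]],
      [[0, - \<beta>, - \<alpha>], [- \<beta>, 0, 0], [\<alpha>, 0, 0]]]] ! a ! b ! c ! e"

lemma parties_eq: "parties = {1, 2, 3, 4}"
  by (auto simp: parties_def)

lemma less_2_or_3_iff: "n < 2 \<longleftrightarrow> n = 0 \<or> n = 1" "n < 3 \<longleftrightarrow> n = 0 \<or> n = 1 \<or> n = 2" for n :: nat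
  by auto

lemma lessThan_3: "{..<3::nat} = {0, 1, 2}"
  by auto

lemma ket_eq:
  assumes "x \<in> multi_index dims2333 parties"
  shows "ket a b c e x = (if x 1 = a \<and> x 2 = b \<and> x 3 = c \<and> x 4 = e then 1 else 0)"
  using assms by (simp add: ket_def tensor_def std_basis_def parties_eq)

text \<open>Replaces the sum of 24 kets by a lookup that \<open>simp\<close> evaluates at concrete
  indices, after a split into all 54 basis vectors.\<close>

lemma phi2333_eq:
  assumes "x \<in> multi_index dims2333 parties"
  shows "phi2333 \<alpha> \<beta> x = of_real (coeff2333 \<alpha> \<beta> (x 1) (x 2) (x 3) (x 4))"
proof -
  have "x 1 < 2" "x 2 < 3" "x 3 < 3" "x 4 < 3"
    using assms by (auto simp: multi_index_def dims2333_def parties_eq PiE_def Pi_def)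
  then show ?thesis
    unfolding phi2333_def ket_eq[OF assms] less_2_or_3_iff
    by (elim disjE) (simp_all add: coeff2333_def)
qed

lemma phi2333_in_state_space: "phi2333 \<alpha> \<beta> \<in> state_space dims2333 parties"
  by (simp add: state_space_def phi2333_def ket_def tensor_def)

text \<open>Each of the six rows has two entries \<plusminus>\<alpha> and two entries
  \<plusminus>\<beta>. Distinct rows have disjoint supports or products that cancel in pairs. The
  same holds for the other two cuts below.\<close>

lemma coeff2333_orthonormal_12:
  assumes "\<alpha>\<^sup>2 + \<beta>\<^sup>2 = 1/12" "a < 2" "b < 3" "a' < 2" "b' < 3"
  shows "(\<Sum>c<3. \<Sum>e<3. coeff2333 \<alpha> \<beta> a b c e * coeff2333 \<alpha> \<beta> a' b' c e) =
    (if a = a' \<and> b = b' then 1/6 else 0)"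
proof -
  \<comment> \<open>Used as a rewrite rule, this removes the square of \<beta>, so the diagonal sums
    simplify to constants.\<close>
  have "\<beta> * \<beta> = 1/12 - \<alpha> * \<alpha>"
    using assms(1) by (simp add: power2_eq_square)
  with assms(2-) show ?thesis
    unfolding less_2_or_3_iff lessThan_3
    by (elim disjE) (simp_all add: coeff2333_def)
qed

lemma coeff2333_orthonormal_13:
  assumes "\<alpha>\<^sup>2 + \<beta>\<^sup>2 = 1/12" "a < 2" "c < 3" "a' < 2" "c' < 3"
  shows "(\<Sum>b<3. \<Sum>e<3. coeff2333 \<alpha> \<beta> a b c e * coeff2333 \<alpha> \<beta> a' b c' e) =
    (if a = a' \<and> c = c' then 1/6 else 0)"
proof -
  have "\<beta> * \<beta> = 1/12 - \<alpha> * \<alpha>"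
    using assms(1) by (simp add: power2_eq_square)
  with assms(2-) show ?thesis
    unfolding less_2_or_3_iff lessThan_3
    by (elim disjE) (simp_all add: coeff2333_def)
qed

lemma coeff2333_orthonormal_14:
  assumes "\<alpha>\<^sup>2 + \<beta>\<^sup>2 = 1/12" "a < 2" "e < 3" "a' < 2" "e' < 3"
  shows "(\<Sum>b<3. \<Sum>c<3. coeff2333 \<alpha> \<beta> a b c e * coeff2333 \<alpha> \<beta> a' b c e') =
    (if a = a' \<and> e = e' then 1/6 else 0)"
proof -
  have "\<beta> * \<beta> = 1/12 - \<alpha> * \<alpha>"
    using assms(1) by (simp add: power2_eq_square)
  with assms(2-) show ?thesis
    unfolding less_2_or_3_iff lessThan_3
    by (elim disjE) (simp_all add: coeff2333_def)
qed

section \<open>Reductions onto party 1 and one further party\<close>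

lemma multi_index_pair:
  assumes "x \<in> multi_index dims2333 {1, i}" "y \<in> multi_index dims2333 {1, i}" "i \<noteq> 1"
  shows "x 1 < 2" "x i < 3" "x = y \<longleftrightarrow> x 1 = y 1 \<and> x i = y i"
proof -
  show "x 1 < 2" "x i < 3"
    using assms by (auto simp: multi_index_def dims2333_def PiE_def Pi_def)
  show "x = y \<longleftrightarrow> x 1 = y 1 \<and> x i = y i"
    using assms unfolding multi_index_def by (auto intro: PiE_ext)
qed

text \<open>Treats the three cuts uniformly. In \<open>C\<close>, the function \<open>w\<close>
  starts out constantly \<open>b\<close>, so that after the updates at \<open>j\<close> and
  \<open>k\<close> the remaining slot \<open>i\<close> among 2, 3, 4 holds \<open>b\<close>.\<close>

lemma phi2333_mixed_pairI:
  fixes \<alpha> \<beta> :: real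
  defines "C \<equiv> \<lambda>i j k a b p q. let w = (\<lambda>_. b)(j := p, k := q)
    in coeff2333 \<alpha> \<beta> a (w 2) (w 3) (w 4)"
  assumes ijk: "{1, i, j, k} = parties" "distinct [1, i, j, k]"
    and orth: "\<And>a b a' b'. \<lbrakk>a < 2; b < 3; a' < 2; b' < 3\<rbrakk> \<Longrightarrow>
      (\<Sum>p<3. \<Sum>q<3. C i j k a b p q * C i j k a' b' p q) = (if a = a' \<and> b = b' then 1/6 else 0)"
  shows "maximally_mixed dims2333 {1, i}
    (partial_trace dims2333 {1, i} {j, k} (density (phi2333 \<alpha> \<beta>)))"
  unfolding maximally_mixed_def
proof (intro ballI)
  fix x y assume x: "x \<in> multi_index dims2333 {1, i}" and y: "y \<in> multi_index dims2333 {1, i}"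
  \<comment> \<open>The order of the updates is the one produced by splitting off \<open>j\<close>
    before \<open>k\<close> with \<open>sum_multi_index_insert\<close>.\<close>
  let ?m = "\<lambda>u p q. merge {1, i} {j, k} (u, (\<lambda>_. undefined)(k := q, j := p))"
  let ?c = "\<lambda>u. C i j k (u 1) (u i)"
  have dims: "dims2333 j = 3" "dims2333 k = 3" "dims2333 1 = 2" "dims2333 i = 3"
    using ijk(2) by (auto simp: dims2333_def)
  have phi: "phi2333 \<alpha> \<beta> (?m u p q) = of_real (?c u p q)"
    if u: "u \<in> multi_index dims2333 {1, i}" and "p < 3" "q < 3" for u p q
  proof -
    have "?m u p q \<in> multi_index dims2333 parties"
      unfolding ijk(1)[symmetric] multi_index_def
      using u that(2,3) dims ijk(2)
      by (auto simp: multi_index_def merge_def PiE_def Pi_def extensional_def)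
    moreover have "?m u p q n = ((\<lambda>_. u i)(j := p, k := q)) n" if "n \<in> parties" "n \<noteq> 1" for n
      using that ijk(2) unfolding ijk(1)[symmetric] by (auto simp: merge_def)
    moreover have "?m u p q 1 = u 1"
      by (simp add: merge_def)
    ultimately show ?thesis
      by (simp add: phi2333_eq C_def Let_def parties_eq del: fun_upd_apply One_nat_def)
  qed
  have "partial_trace dims2333 {1, i} {j, k} (density (phi2333 \<alpha> \<beta>)) x y =
      (\<Sum>p<3. \<Sum>q<3. phi2333 \<alpha> \<beta> (?m x p q) * cnj (phi2333 \<alpha> \<beta> (?m y p q)))"
    unfolding partial_trace_def density_def
    using ijk(2) by (simp add: sum_multi_index_insert sum_multi_index_empty dims)
  \<comment> \<open>The amplitudes are real, so the conjugation disappears.\<close>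
  also have "\<dots> = (\<Sum>p<3. \<Sum>q<3. of_real (?c x p q * ?c y p q))"
    using x y by (intro sum.cong refl) (simp add: phi del: One_nat_def)
  also have "\<dots> = of_real (\<Sum>p<3. \<Sum>q<3. ?c x p q * ?c y p q)"
    by (simp only: of_real_sum)
  also have "(\<Sum>p<3. \<Sum>q<3. ?c x p q * ?c y p q) = (if x 1 = y 1 \<and> x i = y i then 1/6 else 0)"
    using x y ijk(2) by (intro orth multi_index_pair) auto
  also have "(x 1 = y 1 \<and> x i = y i) = (x = y)"
    using multi_index_pair(3)[OF x y] ijk(2) by auto
  also have "complex_of_real (if x = y then 1/6 else 0) =
      (if x = y then 1 else 0) / of_nat (\<Prod>i\<in>{1, i}. dims2333 i)"
    using ijk(2) dims by (simp del: One_nat_def)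
  finally show "partial_trace dims2333 {1, i} {j, k} (density (phi2333 \<alpha> \<beta>)) x y =
      (if x = y then 1 else 0) / of_nat (\<Prod>i\<in>{1, i}. dims2333 i)" .
qed

lemma phi2333_mixed_pair:
  fixes \<alpha> \<beta> :: real
  assumes "\<alpha>\<^sup>2 + \<beta>\<^sup>2 = 1/12"
  shows "maximally_mixed dims2333 {1, 2} (partial_trace dims2333 {1, 2} {3, 4} (density (phi2333 \<alpha> \<beta>)))"
    and "maximally_mixed dims2333 {1, 3} (partial_trace dims2333 {1, 3} {2, 4} (density (phi2333 \<alpha> \<beta>)))"
    and "maximally_mixed dims2333 {1, 4} (partial_trace dims2333 {1, 4} {2, 3} (density (phi2333 \<alpha> \<beta>)))"
  by (rule phi2333_mixed_pairI;
      simp add: parties_eq insert_commute coeff2333_orthonormal_12[OF assms]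
        coeff2333_orthonormal_13[OF assms] coeff2333_orthonormal_14[OF assms])+

section \<open>Admissible subsets and absolute maximal entanglement\<close>

lemma small_subset_parties:
  assumes "S \<subseteq> parties" "(\<Prod>i\<in>S. dims2333 i) \<le> (\<Prod>i\<in>parties - S. dims2333 i)"
  shows "S \<in> {{}, {1}, {2}, {3}, {4}, {1, 2}, {1, 3}, {1, 4}}"
proof -
  have "S \<in> Pow {1, 2, 3, 4}"
    using assms(1) by (simp add: parties_eq)
  then show ?thesis
    using assms(2) unfolding parties_eq Pow_insert Pow_empty
      image_insert image_empty image_Un Un_insert_left Un_empty_left
    \<comment> \<open>Of the sixteen subsets, any with two parties of dimension 3 has dimension at
      least 9, against at most 6 for its complement.\<close>
    by (elim insertE emptyE) (simp_all add: dims2333_def insert_Diff_if)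
qed

lemma phi2333_absolutely_maximally_entangled:
  assumes "\<alpha>\<^sup>2 + \<beta>\<^sup>2 = 1/12"
  shows "absolutely_maximally_entangled dims2333 parties (phi2333 \<alpha> \<beta>)"
proof -
  let ?mixed = "\<lambda>S. maximally_mixed dims2333 S
    (partial_trace dims2333 S (parties - S) (density (phi2333 \<alpha> \<beta>)))"
  have pairs: "?mixed {1, 2}" "?mixed {1, 3}" "?mixed {1, 4}"
    using phi2333_mixed_pair[OF assms] by (simp_all add: parties_eq insert_Diff_if)
  have reduce: "?mixed S" if "?mixed (insert k S)" "k \<in> parties" "k \<notin> S" "finite S" for k S
  proof -
    \<comment> \<open>Brings the complement into the shape that
      \<open>maximally_mixed_reduce\<close> expects.\<close>
    have "parties - S = insert k (parties - insert k S)"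
      using that by auto
    with that show ?thesis
      using maximally_mixed_reduce[of dims2333 k S "parties - insert k S"]
      by (simp add: dims2333_def)
  qed
  have single: "?mixed {1}" "?mixed {2}" "?mixed {3}" "?mixed {4}"
    using pairs reduce[of 2 "{1}"] reduce[of 1 "{2}"] reduce[of 1 "{3}"] reduce[of 1 "{4}"]
    by (simp_all add: parties_eq insert_commute)
  then have empty: "?mixed {}"
    using reduce[of 1 "{}"] by (simp add: parties_eq)
  then have "state_norm dims2333 parties (phi2333 \<alpha> \<beta>) = 1"
    by (simp add: state_norm_eq_1)
  moreover have "?mixed S"
    if "S \<subseteq> parties" "(\<Prod>i\<in>S. dims2333 i) \<le> (\<Prod>i\<in>parties - S. dims2333 i)" for S
    using small_subset_parties[OF that] pairs single empty by (elim insertE) simp_all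
  ultimately show ?thesis
    unfolding absolutely_maximally_entangled_def pure_state_def
    using phi2333_in_state_space by blast
qed

section \<open>The closed forms of \<alpha> and \<beta>\<close>

lemma amplitudes2333:
  fixes \<alpha> \<beta> s :: real
  assumes s: "s \<in> {1, -1}"
    and \<alpha>: "\<alpha> = 1/6 * sqrt (3/2 + s * (sqrt 65 / 6))" and \<beta>: "\<beta> = 1 / (54 * \<alpha>)"
  shows "\<beta> = 1/6 * sqrt (3/2 - s * (sqrt 65 / 6))" "\<alpha>\<^sup>2 + \<beta>\<^sup>2 = 1/12"
proof -
  define t where "t = s * (sqrt 65 / 6)"
  \<comment> \<open>Ensures that both radicands \<open>3/2 + t\<close> and \<open>3/2 - t\<close>
    are positive.\<close>
  have "sqrt 65 < 9"
    by (rule real_less_lsqrt) auto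
  then have t: "\<bar>t\<bar> < 3/2"
    using s by (auto simp: t_def)
  have t2: "t\<^sup>2 = 65/36"
    using s by (auto simp: t_def power_mult_distrib power_divide)
  \<comment> \<open>Here 9/4 - 65/36 = 4/9. With the two prefactors 1/6 the product becomes 1/54,
    the constant in the definition of \<beta>.\<close>
  have "sqrt (3/2 + t) * sqrt (3/2 - t) = sqrt ((2/3)\<^sup>2)"
    using t2 by (simp add: real_sqrt_mult[symmetric] power2_eq_square algebra_simps)
  then have "sqrt (3/2 + t) * sqrt (3/2 - t) = 2/3"
    by simp
  moreover have "sqrt (3/2 + t) > 0"
    using t by simp
  ultimately show \<beta>': "\<beta> = 1/6 * sqrt (3/2 - s * (sqrt 65 / 6))"
    unfolding \<beta> \<alpha> t_def[symmetric] by (simp add: field_simps)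
  \<comment> \<open>In the sum of the squares \<open>t\<close> cancels, leaving 3/36.\<close>
  show "\<alpha>\<^sup>2 + \<beta>\<^sup>2 = 1/12"
    unfolding \<beta>' \<alpha> t_def[symmetric] using t by (simp add: power_mult_distrib power_divide field_simps)
qed

theorem mainTheorem2:
  shows "(\<forall>s\<in>{1, -1::real}. \<forall>\<alpha> \<beta> :: real.
            \<alpha> = 1/6 * sqrt (3/2 + s * (sqrt 65 / 6)) \<and> \<beta> = 1 / (54 * \<alpha>) \<longrightarrow>
              \<beta> = 1/6 * sqrt (3/2 - s * (sqrt 65 / 6)) \<and>
              absolutely_maximally_entangled dims2333 parties (phi2333 \<alpha> \<beta>))
       \<and> (\<exists>\<psi>. absolutely_maximally_entangled dims2333 parties \<psi>)"
proof -
  have "\<beta> = 1/6 * sqrt (3/2 - s * (sqrt 65 / 6)) \<and>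
      absolutely_maximally_entangled dims2333 parties (phi2333 \<alpha> \<beta>)"
    if "s \<in> {1, -1}" "\<alpha> = 1/6 * sqrt (3/2 + s * (sqrt 65 / 6))" "\<beta> = 1 / (54 * \<alpha>)" for s \<alpha> \<beta> :: real
    using amplitudes2333[OF that] phi2333_absolutely_maximally_entangled by blast
  then show ?thesis
    by blast
qed

end
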